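(* Let $X\subseteq\mathbb R^d$ be nonempty, closed and convex, let $f$ be differentiable on an open convex set $U\supseteq X$, let $h:U\to\mathbb R$ be continuously differentiable and 1-strongly convex with respect to $\|\cdot\|_1$, and let $\lambda>0$. Then for every $\mathbf x\in X$, $$r(\mathbf x)\ge\sqrt{2/\lambda}\;r_3(\mathbf x),$$ where $$r(\mathbf x)=\inf\{\|\mathbf v\|_\infty:\mathbf v\in\partial(f+\delta_X)(\mathbf x)\},\qquad r_3(\mathbf x)=\sqrt{-\min_{\mathbf y\in X}Q(\mathbf x,\mathbf y)},\qquad Q(\mathbf x,\mathbf y)=\langle\nabla f(\mathbf x),\mathbf y-\mathbf x\rangle+\frac1\lambda D_h(\mathbf y,\mathbf x).$$
   Context: $D_h(\mathbf u,\mathbf v)=h(\mathbf u)-h(\mathbf v)-\langle\nabla h(\mathbf v),\mathbf u-\mathbf v\rangle$ is the Bregman divergence of $h$; 1-strong convexity with respect to $\|\cdot\|_1$ means $D_h(\mathbf u,\mathbf v)\ge\frac12\|\mathbf u-\mathbf v\|_1^2$. $\delta_X$ is the indicator function of $X$ ($0$ on $X$, $+\infty$ off $X$) and $\partial$ is the Fréchet subdifferential, so $\partial(f+\delta_X)(\mathbf x)=\nabla f(\mathbf x)+N_X(\mathbf x)$ for $\mathbf x\in X$, with $N_X$ the normal cone. *)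

theory Defs
  imports "HOL-Analysis.Analysis"
begin

definition gradient :: "('a::real_inner \<Rightarrow> real) \<Rightarrow> 'a \<Rightarrow> 'a" where
  "gradient f x = (THE D. GDERIV f x :> D)"

definition l1_norm :: "real ^ 'n \<Rightarrow> real" where
  "l1_norm x = (\<Sum>i\<in>UNIV. \<bar>x $ i\<bar>)"

definition bregman :: "('a::real_inner \<Rightarrow> real) \<Rightarrow> 'a \<Rightarrow> 'a \<Rightarrow> real" where
  "bregman h u v = h u - h v - gradient h v \<bullet> (u - v)"

definition continuously_differentiable_on ::
    "('a::real_inner \<Rightarrow> real) \<Rightarrow> 'a set \<Rightarrow> bool" where
  "continuously_differentiable_on h U \<longleftrightarrow>
     h differentiable_on U \<and> continuous_on U (gradient h)"

definition strongly_convex_l1_on :: "(real ^ 'n \<Rightarrow> real) \<Rightarrow> (real ^ 'n) set \<Rightarrow> bool" where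
  "strongly_convex_l1_on h U \<longleftrightarrow>
     (\<forall>u\<in>U. \<forall>v\<in>U. bregman h u v \<ge> (l1_norm (u - v))\<^sup>2 / 2)"

definition indicator_fun :: "'a set \<Rightarrow> 'a \<Rightarrow> ereal" where
  "indicator_fun X x = (if x \<in> X then 0 else \<infinity>)"

definition frechet_subdifferential :: "('a::real_inner \<Rightarrow> ereal) \<Rightarrow> 'a \<Rightarrow> 'a set" where
  "frechet_subdifferential g x =
     {v. \<bar>g x\<bar> \<noteq> \<infinity> \<and>
         Liminf (at x) (\<lambda>y. (g y - g x - ereal (v \<bullet> (y - x))) / ereal (norm (y - x))) \<ge> 0}"

definition residual :: "(real ^ 'n \<Rightarrow> real) \<Rightarrow> (real ^ 'n) set \<Rightarrow> real ^ 'n \<Rightarrow> ereal" where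
  "residual f X x =
     (INF v \<in> frechet_subdifferential (\<lambda>y. ereal (f y) + indicator_fun X y) x. ereal (infnorm v))"

definition prox_model :: "('a::real_inner \<Rightarrow> real) \<Rightarrow> ('a \<Rightarrow> real) \<Rightarrow> real \<Rightarrow> 'a \<Rightarrow> 'a \<Rightarrow> real" where
  "prox_model f h lam x y = gradient f x \<bullet> (y - x) + (1 / lam) * bregman h y x"

(* The minimum is the least element of the set of values, not an infimum: the LEAST is
   determined only when the minimum over X is attained. *)
definition prox_residual ::
    "('a::real_inner \<Rightarrow> real) \<Rightarrow> ('a \<Rightarrow> real) \<Rightarrow> real \<Rightarrow> 'a set \<Rightarrow> 'a \<Rightarrow> real" where
  "prox_residual f h lam X x = sqrt (- (LEAST q. q \<in> prox_model f h lam x ` X))"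

end

theory Submission
  imports Defs
begin

text \<open>
  A Frechet subgradient \<open>v\<close> of \<open>f + \<delta>\<^sub>X\<close> at \<open>x\<close> satisfies
  \<open>\<langle>v, y - x\<rangle> \<le> \<langle>\<nabla>f x, y - x\<rangle>\<close> for \<open>y \<in> X\<close>, as one sees by approaching \<open>x\<close> along the
  segment to \<open>y\<close>. With strong convexity and Hoelder's inequality,
  \<open>Q(x, y) \<ge> t\<^sup>2 / (2 \<lambda>) - t \<parallel>v\<parallel>\<^sub>\<infinity> \<ge> - \<lambda> \<parallel>v\<parallel>\<^sub>\<infinity>\<^sup>2 / 2\<close>, where \<open>t = \<parallel>y - x\<parallel>\<^sub>1\<close>.
  The same quadratic growth makes \<open>Q(x, \<cdot>)\<close> coercive, so its minimum over \<open>X\<close> is attained.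
\<close>

text \<open>The derivative is a linear functional, hence the inner product with the vector
  \<open>adjoint f' 1\<close>. Only one vector represents it, so the definite description in
  \<open>gradient\<close> picks out that vector.\<close>

lemma GDERIV_gradient:
  fixes f :: "'a::euclidean_space \<Rightarrow> real"
  assumes "f differentiable (at x)"
  shows "GDERIV f x :> gradient f x"
proof -
  obtain f' where f': "(f has_derivative f') (at x)"
    using assms by (auto simp: differentiable_def)
  then have "linear f'"
    by (rule has_derivative_linear)
  then have "f' = (\<lambda>h. h \<bullet> adjoint f' 1)"
    using adjoint_works[of f' _ 1] by auto
  with f' have ex: "GDERIV f x :> adjoint f' 1"
    by (simp add: gderiv_def)
  have "D = adjoint f' 1" if "GDERIV f x :> D" for D
    using has_derivative_unique[OF that[unfolded gderiv_def] ex[unfolded gderiv_def]]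
    by (metis vector_eq_ldot)
  with ex show ?thesis
    unfolding gradient_def by (rule theI)
qed

lemma inner_le_l1_infnorm: "\<bar>u \<bullet> v\<bar> \<le> l1_norm u * infnorm v"
proof -
  have "\<bar>u \<bullet> v\<bar> \<le> (\<Sum>i\<in>UNIV. \<bar>u $ i * v $ i\<bar>)"
    by (simp add: inner_vec_def sum_abs)
  also have "\<dots> \<le> (\<Sum>i\<in>UNIV. \<bar>u $ i\<bar> * infnorm v)"
    by (intro sum_mono) (simp add: abs_mult component_le_infnorm_cart mult_left_mono)
  finally show ?thesis
    by (simp add: l1_norm_def sum_distrib_right)
qed

lemma frechet_subdifferential_inner_le_gradient:
  fixes f :: "'a::euclidean_space \<Rightarrow> real"
  assumes "convex X" "x \<in> X" "y \<in> X" and diff: "f differentiable (at x)"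
    and v: "v \<in> frechet_subdifferential (\<lambda>y. ereal (f y) + indicator_fun X y) x"
  shows "v \<bullet> (y - x) \<le> gradient f x \<bullet> (y - x)"
proof (cases "y = x")
  case False
  define n where "n = norm (y - x)"
  have n: "n > 0"
    using False by (simp add: n_def)
  define F where "F = (\<lambda>y. (ereal (f y) + indicator_fun X y - (ereal (f x) + indicator_fun X x)
      - ereal (v \<bullet> (y - x))) / ereal (norm (y - x)))"
  have lim: "Liminf (at x) F \<ge> 0"
    using v by (simp add: frechet_subdifferential_def F_def)
  \<comment> \<open>One \<open>e * n\<close> is the slack allowed by the lower limit, the other is
    the first-order error of \<open>f\<close>; both are of size \<open>e * (t * n)\<close> at the
    test point and are rescaled by \<open>1 / t\<close>.\<close>
  have bound: "v \<bullet> (y - x) \<le> gradient f x \<bullet> (y - x) + 2 * e * n" if e: "e > 0" for e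
  proof -
    have "\<forall>\<^sub>F p in at x. ereal (- e) < F p"
      using lim e unfolding le_Liminf_iff by auto
    then obtain d1 where d1: "d1 > 0" "\<And>p. p \<noteq> x \<Longrightarrow> dist p x < d1 \<Longrightarrow> ereal (- e) < F p"
      by (auto simp: eventually_at)
    have "(f has_derivative (\<lambda>h. h \<bullet> gradient f x)) (at x)"
      using GDERIV_gradient[OF diff] by (simp add: gderiv_def)
    then obtain d2 where d2: "d2 > 0" "\<And>p. norm (p - x) < d2 \<Longrightarrow>
        norm (f p - f x - (p - x) \<bullet> gradient f x) \<le> e * norm (p - x)"
      using e unfolding has_derivative_at_alt by blast
    \<comment> \<open>The cap 1 keeps the test point on the segment, hence in \<open>X\<close>; the
      factor 1/2 puts its distance \<open>t * n\<close> from \<open>x\<close> strictly below both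
      radii.\<close>
    define t where "t = min 1 (min d1 d2 / (2 * n))"
    have t: "0 < t" "t \<le> 1"
      using n d1 d2 by (auto simp: t_def)
    have "t * n \<le> min d1 d2 / (2 * n) * n"
      using n by (intro mult_right_mono) (auto simp: t_def)
    then have tn: "t * n < d1" "t * n < d2"
      using n d1 d2 by (auto simp: min_def split: if_splits)
    define p where "p = x + t *\<^sub>R (y - x)"
    have px: "p - x = t *\<^sub>R (y - x)"
      by (simp add: p_def)
    have "p = (1 - t) *\<^sub>R x + t *\<^sub>R y"
      by (simp add: p_def algebra_simps)
    then have "p \<in> X"
      using assms(1-3) t by (simp add: convex_alt)
    have norm_px: "norm (p - x) = t * n"
      using t by (simp add: px n_def)
    have "p \<noteq> x" "dist p x < d1"
      using False t tn norm_px by (auto simp: p_def dist_norm)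
    then have "ereal (- e) < F p"
      by (rule d1(2))
    \<comment> \<open>Both indicator terms vanish since \<open>p\<close> and \<open>x\<close> lie in
      \<open>X\<close>, so the extended-real quotient is a real one.\<close>
    then have "- e < (f p - f x - v \<bullet> (p - x)) / (t * n)"
      using \<open>p \<in> X\<close> \<open>x \<in> X\<close> n t by (simp add: F_def indicator_fun_def norm_px)
    then have "- e * (t * n) < f p - f x - v \<bullet> (p - x)"
      using n t by (simp add: pos_less_divide_eq)
    moreover have "f p - f x - (p - x) \<bullet> gradient f x \<le> e * (t * n)"
      using d2(2)[of p] tn norm_px by auto
    ultimately have "v \<bullet> (p - x) \<le> gradient f x \<bullet> (p - x) + 2 * e * (t * n)"
      by (simp add: inner_commute)
    then have "t * (v \<bullet> (y - x)) \<le> t * (gradient f x \<bullet> (y - x) + 2 * e * n)"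
      by (simp add: px algebra_simps)
    then show ?thesis
      using t by simp
  qed
  show ?thesis
  proof (rule field_le_epsilon)
    fix e :: real
    assume "e > 0"
    with bound[of "e / (2 * n)"] n show "v \<bullet> (y - x) \<le> gradient f x \<bullet> (y - x) + e"
      by simp
  qed
qed simp

lemma prox_model_ge:
  fixes f h :: "real ^ 'n \<Rightarrow> real"
  assumes "strongly_convex_l1_on h U" "x \<in> U" "y \<in> U" "lam > 0"
  shows "prox_model f h lam x y \<ge> gradient f x \<bullet> (y - x) + (l1_norm (y - x))\<^sup>2 / (2 * lam)"
proof -
  have "(1 / lam) * ((l1_norm (y - x))\<^sup>2 / 2) \<le> (1 / lam) * bregman h y x"
    using assms by (intro mult_left_mono) (auto simp: strongly_convex_l1_on_def)
  then show ?thesis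
    by (simp add: prox_model_def mult.commute)
qed

lemma prox_model_attains_min:
  fixes f h :: "real ^ 'n \<Rightarrow> real"
  assumes "closed X" "X \<subseteq> U" "continuous_on U h" "strongly_convex_l1_on h U" "lam > 0" "x \<in> X"
  obtains z where "z \<in> X" "\<And>y. y \<in> X \<Longrightarrow> prox_model f h lam x z \<le> prox_model f h lam x y"
proof -
  let ?Q = "prox_model f h lam x"
  \<comment> \<open>At this distance the growth \<open>s\<^sup>2 / (2 * lam)\<close> catches up with
    the linear term \<open>norm (gradient f x) * s\<close>. Beyond it \<open>?Q\<close> is
    nonnegative, while \<open>?Q x = 0\<close> with \<open>x\<close> in the ball, so a minimizer
    over the compact part is global.\<close>
  define R where "R = 2 * lam * norm (gradient f x)"
  have "R \<ge> 0"
    using \<open>lam > 0\<close> by (simp add: R_def)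
  have "continuous_on (X \<inter> cball x R) h"
    using assms(2,3) by (meson continuous_on_subset inf.coboundedI1)
  then have "continuous_on (X \<inter> cball x R) ?Q"
    unfolding prox_model_def bregman_def by (intro continuous_intros)
  moreover have "compact (X \<inter> cball x R)"
    using \<open>closed X\<close> by (simp add: closed_Int_compact)
  moreover have "x \<in> X \<inter> cball x R"
    using \<open>x \<in> X\<close> \<open>R \<ge> 0\<close> by simp
  ultimately obtain z where z: "z \<in> X" "\<And>y. y \<in> X \<inter> cball x R \<Longrightarrow> ?Q z \<le> ?Q y"
    using continuous_attains_inf[of "X \<inter> cball x R" ?Q] by blast
  have "?Q z \<le> ?Q y" if "y \<in> X" for y
  proof (cases "dist x y \<le> R")
    case True
    then show ?thesis
      using z(2) that by simp
  next
    case False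
    define s where "s = norm (y - x)"
    have s: "s > R"
      using False by (simp add: s_def dist_norm norm_minus_commute)
    have "gradient f x \<bullet> (y - x) \<ge> - (norm (gradient f x) * s)"
      using Cauchy_Schwarz_ineq2[of "gradient f x" "y - x"] by (simp add: s_def)
    \<comment> \<open>The growth is known in the l1 norm but the ball is Euclidean; the l1 norm
      dominates the Euclidean one.\<close>
    moreover have "s \<le> l1_norm (y - x)"
      unfolding s_def l1_norm_def by (rule norm_le_l1_cart)
    then have "s\<^sup>2 / (2 * lam) \<le> (l1_norm (y - x))\<^sup>2 / (2 * lam)"
      using \<open>lam > 0\<close> by (intro divide_right_mono power_mono) (auto simp: s_def)
    moreover have "norm (gradient f x) * s \<le> s\<^sup>2 / (2 * lam)"
      using s \<open>lam > 0\<close> mult_right_mono[of R s s]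
      by (simp add: R_def s_def field_simps power2_eq_square)
    ultimately have "0 \<le> ?Q y"
      using prox_model_ge[of h U x y lam f] assms that by (auto simp: subset_iff)
    moreover have "?Q x = 0"
      by (simp add: prox_model_def bregman_def)
    ultimately show ?thesis
      using z(2)[of x] \<open>x \<in> X\<close> \<open>R \<ge> 0\<close> by simp
  qed
  with z(1) show ?thesis
    by (rule that)
qed

theorem lemma2:
  fixes X U :: "(real ^ 'n) set"
    and f h :: "real ^ 'n \<Rightarrow> real"
    and lam :: real
    and x :: "real ^ 'n"
  assumes "X \<noteq> {}" and "closed X" and "convex X"
    and "open U" and "convex U" and "X \<subseteq> U"
    and "f differentiable_on U"
    and "continuously_differentiable_on h U"
    and "strongly_convex_l1_on h U"
    and "lam > 0"
    and "x \<in> X"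
  shows "residual f X x \<ge> ereal (sqrt (2 / lam) * prox_residual f h lam X x)"
proof -
  let ?Q = "prox_model f h lam x"
  have "x \<in> U"
    using assms by blast
  have diff: "f differentiable (at x)"
    using assms \<open>x \<in> U\<close> by (metis at_within_open differentiable_on_def)
  have "continuous_on U h"
    using assms(8) by (simp add: continuously_differentiable_on_def differentiable_imp_continuous_on)
  then obtain z where z: "z \<in> X" "\<And>y. y \<in> X \<Longrightarrow> ?Q z \<le> ?Q y"
    using prox_model_attains_min[of X U h lam x f] assms by metis
  \<comment> \<open>Attainment identifies the \<open>LEAST\<close> with an actual value of the
    model.\<close>
  have "(LEAST q. q \<in> ?Q ` X) = ?Q z"
    using z by (intro Least_equality) auto
  then have res: "prox_residual f h lam X x = sqrt (- ?Q z)"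
    by (simp add: prox_residual_def)
  have "sqrt (2 / lam) * sqrt (- ?Q z) \<le> infnorm v"
    if v: "v \<in> frechet_subdifferential (\<lambda>y. ereal (f y) + indicator_fun X y) x" for v
  proof -
    define t where "t = l1_norm (z - x)"
    define b where "b = infnorm v"
    have "v \<bullet> (z - x) \<le> gradient f x \<bullet> (z - x)"
      using frechet_subdifferential_inner_le_gradient[OF _ _ z(1) diff v] assms by blast
    moreover have "- (t * b) \<le> v \<bullet> (z - x)"
      using inner_le_l1_infnorm[of "z - x" v] by (simp add: t_def b_def inner_commute)
    moreover have "?Q z \<ge> gradient f x \<bullet> (z - x) + t\<^sup>2 / (2 * lam)"
      unfolding t_def using prox_model_ge assms z(1) by (metis subsetD)
    ultimately have "- ?Q z \<le> t * b - t\<^sup>2 / (2 * lam)"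
      by linarith
    \<comment> \<open>Scaling by \<open>2 / lam\<close> allows completing the square in
      \<open>t\<close>; the discarded square vanishes exactly at \<open>t = lam * b\<close>.\<close>
    then have "2 / lam * - ?Q z \<le> 2 / lam * (t * b - t\<^sup>2 / (2 * lam))"
      using \<open>lam > 0\<close> by (intro mult_left_mono) auto
    also have "\<dots> = b\<^sup>2 - (b - t / lam)\<^sup>2"
      using \<open>lam > 0\<close> by (simp add: field_simps power2_eq_square)
    also have "\<dots> \<le> b\<^sup>2"
      by simp
    finally have "sqrt (2 / lam * - ?Q z) \<le> b"
      by (intro real_le_lsqrt) (auto simp: b_def infnorm_pos_le)
    then show ?thesis
      by (simp only: real_sqrt_mult b_def)
  qed
  then show ?thesis
    unfolding residual_def res by (intro INF_greatest) simp
qed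

end
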